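(* Let $T$ be an arc-colored tournament. If for every integer $k$ with $3\leq k\leq |V(T)|$, every strongly connected $k$-vertex subtournament of $T$ is colored with at least $k-1$ colors, then $T$ has a kernel by rainbow paths.
   Context: All digraphs are finite and simple; paths are directed paths. A tournament is an orientation of a complete graph; a subtournament is an induced subdigraph of a tournament. A digraph is strongly connected if for any two distinct vertices $x,y$ there is a directed $(x,y)$-path. An arc-colored digraph has each arc assigned a color; a subdigraph is colored with at least $r$ colors if at least $r$ distinct colors appear on its arcs. A path is rainbow if any two of its arcs receive distinct colors. A kernel by rainbow paths of an arc-colored digraph $D$ is a set $S\subseteq V(D)$ such that (i) no two vertices of $S$ are connected by a rainbow path in $D$, and (ii) every vertex of $V(D)\setminus S$ can reach some vertex of $S$ by a rainbow path in $D$. *)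

theory Defs
  imports "Graph_Theory.Graph_Theory"
begin

locale tournament = digraph +
  assumes semicomplete:
      "\<lbrakk>u \<in> verts G; v \<in> verts G; u \<noteq> v\<rbrakk> \<Longrightarrow> u \<rightarrow>\<^bsub>G\<^esub> v \<or> v \<rightarrow>\<^bsub>G\<^esub> u"
    and oriented: "u \<rightarrow>\<^bsub>G\<^esub> v \<Longrightarrow> \<not> v \<rightarrow>\<^bsub>G\<^esub> u"

definition colored_with_at_least ::
    "('b \<Rightarrow> 'c) \<Rightarrow> nat \<Rightarrow> ('a, 'b) pre_digraph \<Rightarrow> bool" where
  "colored_with_at_least c r H \<longleftrightarrow> r \<le> card (c ` arcs H)"

definition rainbow_path ::
    "('a, 'b) pre_digraph \<Rightarrow> ('b \<Rightarrow> 'c) \<Rightarrow> 'a \<Rightarrow> 'b awalk \<Rightarrow> 'a \<Rightarrow> bool" where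
  "rainbow_path D c u p v \<longleftrightarrow> pre_digraph.apath D u p v \<and> distinct (map c p)"

definition rainbow_path_kernel ::
    "('a, 'b) pre_digraph \<Rightarrow> ('b \<Rightarrow> 'c) \<Rightarrow> 'a set \<Rightarrow> bool" where
  "rainbow_path_kernel D c S \<longleftrightarrow>
     S \<subseteq> verts D \<and>
     (\<forall>u\<in>S. \<forall>v\<in>S. u \<noteq> v \<longrightarrow> \<not> (\<exists>p. rainbow_path D c u p v)) \<and>
     (\<forall>u\<in>verts D - S. \<exists>v\<in>S. \<exists>p. rainbow_path D c u p v)"

end

theory Submission
  imports Defs "HOL-Library.Sublist" "HOL-Library.Function_Algebras"
begin

text \<open>
  A vertex reached from all others by rainbow paths is a kernel. Suppose a vertex set \<open>W\<close> is minimal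
  without such a root, and let \<open>f x\<close> be a root of \<open>W - {x}\<close>. Then no rainbow path leads from \<open>x\<close> to
  \<open>f x\<close>, so \<open>f x\<close> dominates \<open>x\<close>, and iterating \<open>f\<close> yields a cycle \<open>x\<^sub>0, x\<^sub>1, \<dots>\<close> with arcs from
  \<open>x\<^sub>i\<^sub>+\<^sub>1\<close> to \<open>x\<^sub>i\<close>. A shortest arc from some \<open>t = x\<^sub>i\<close> to some \<open>s = x\<^sub>i\<^sub>+\<^sub>h\<close> with \<open>h \<ge> 2\<close> spans a segment
  that is transitive from \<open>s\<close> down to \<open>t\<close>, except for that arc. Every set formed by \<open>s\<close>, \<open>t\<close> and
  vertices strictly between them is strongly connected, hence has many colors, and it remains to find
  consecutive vertices \<open>x\<^sub>j\<^sub>+\<^sub>1\<close>, \<open>x\<^sub>j\<close> of the segment and paths from \<open>x\<^sub>j\<close> to \<open>t\<close> and from \<open>s\<close> to \<open>x\<^sub>j\<^sub>+\<^sub>1\<close>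
  that form, with the arc from \<open>t\<close> to \<open>s\<close>, a rainbow path.

  For this, colors are turned into unit vectors of a real vector space and distinct colors into
  linear independence. The vertices following \<open>s\<close> are contracted into \<open>s\<close> one after the other; after
  some contractions several labels sit on the same arc, and contracting along a vector in general
  position of their span (rather than along one color) keeps the counting condition alive.
\<close>

text \<open>The first arc has its own labelling \<open>\<alpha>\<close>, since contractions change
  the labels at the source only. The values will be Booleans, arcs, colors or sets of
  vectors.\<close>

fun steps :: "('n \<Rightarrow> 'x) \<Rightarrow> ('n \<Rightarrow> 'n \<Rightarrow> 'x) \<Rightarrow> 'n list \<Rightarrow> 'x list" where
  "steps \<alpha> U [] = []"
| "steps \<alpha> U (p # ps) = \<alpha> p # steps (U p) U ps"

lemma steps_append:
  "steps (U q) U (qs @ ps) = steps (U q) U qs @ steps (U (last (q # qs))) U ps"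
  by (induction qs arbitrary: q) auto

lemma map_steps: "map c (steps \<alpha> U ps) = steps (\<lambda>v. c (\<alpha> v)) (\<lambda>u v. c (U u v)) ps"
  by (induction ps arbitrary: \<alpha>) auto

text \<open>The source is implicit in \<open>\<alpha>\<close>; the label of the arc from the sink
  \<open>t\<close> back to it is kept apart, in the set \<open>B\<close> below.\<close>

definition arc_labels ::
  "('n \<Rightarrow> 'x set) \<Rightarrow> ('n \<Rightarrow> 'n \<Rightarrow> 'x set) \<Rightarrow> 'n \<Rightarrow> 'n set \<Rightarrow> 'x set" where
  "arc_labels \<alpha> U t Y = (\<Union>j\<in>Y. \<alpha> j \<union> U j t \<union> (\<Union>i\<in>Y. U i j))"

text \<open>Contraction of \<open>v\<close> into the source: arcs leaving \<open>v\<close> count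
  from now on as arcs leaving the source.\<close>

lemma arc_labels_insert:
  assumes "\<And>j. j \<in> insert v Y \<Longrightarrow> U j v = {}"
  shows "arc_labels \<alpha> U t (insert v Y) =
    \<alpha> v \<union> U v t \<union> arc_labels (\<lambda>j. \<alpha> j \<union> U v j) U t Y"
  using assms unfolding arc_labels_def by auto

lemma arc_labels_mono:
  assumes "\<And>j. \<alpha> j \<subseteq> \<beta> j"
  shows "arc_labels \<alpha> U t Y \<subseteq> arc_labels \<beta> U t Y"
  using assms unfolding arc_labels_def by fast

subsection \<open>Independent paths around a gap\<close>

context vector_space
begin

text \<open>A lower bound on the dimension of the span, phrased through a finite witness so that it
  makes sense for infinite-dimensional spans too.\<close>

definition rank_ge :: "'b set \<Rightarrow> nat \<Rightarrow> bool" where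
  "rank_ge S k \<longleftrightarrow> (\<exists>J. J \<subseteq> span S \<and> independent J \<and> finite J \<and> card J = k)"

text \<open>Take \<open>v\<close> outside the old subspaces and \<open>u\<close> outside the new
  one. Each old subspace meets the line \<open>v + r *s u\<close> at most once; the new one, if it
  contains \<open>v\<close>, meets it nowhere else. An infinite field leaves a free
  \<open>r\<close>.\<close>

lemma subspace_avoids_subspaces:
  assumes inf: "infinite (UNIV :: 'a set)" and "finite \<S>" and U: "subspace U"
    and "\<And>S. S \<in> \<S> \<Longrightarrow> subspace S \<and> \<not> U \<subseteq> S"
  shows "\<exists>v\<in>U. \<forall>S\<in>\<S>. v \<notin> S"
  using assms(2,4)
proof (induction \<S> rule: finite_induct)
  case empty
  then show ?case using subspace_0[OF U] by blast
next
  case (insert S \<S>)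
  then obtain v where v: "v \<in> U" "\<And>R. R \<in> \<S> \<Longrightarrow> v \<notin> R" by blast
  obtain u where u: "u \<in> U" "u \<notin> S" using insert.prems by blast
  have sub: "subspace R" if "R \<in> insert S \<S>" for R using insert.prems that by blast
  show ?case
  proof (cases "v \<in> S")
    case False
    then show ?thesis using v by blast
  next
    case True
    have bad: "finite {r. v + r *s u \<in> R}" if R: "R \<in> \<S>" for R
    proof -
      have "r = r'" if r: "v + r *s u \<in> R" "v + r' *s u \<in> R" for r r'
      proof (rule ccontr)
        assume ne: "r \<noteq> r'"
        have sR: "subspace R" using sub R by blast
        have "(v + r *s u) - (v + r' *s u) \<in> R" by (rule subspace_diff[OF sR r])
        then have "(r - r') *s u \<in> R" by (simp add: scale_left_diff_distrib)
        then have "inverse (r - r') *s ((r - r') *s u) \<in> R" by (rule subspace_scale[OF sR])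
        then have "u \<in> R" using ne by simp
        then have "r *s u \<in> R" by (rule subspace_scale[OF sR])
        then have "(v + r *s u) - r *s u \<in> R" using r(1) subspace_diff[OF sR] by blast
        then show False using v(2) R by simp
      qed
      then have "is_singleton {r. v + r *s u \<in> R} \<or> {r. v + r *s u \<in> R} = {}"
        unfolding is_singleton_def by blast
      then show ?thesis by (auto simp: is_singleton_def)
    qed
    have "finite (insert 0 (\<Union>R\<in>\<S>. {r. v + r *s u \<in> R}))"
      using insert.hyps bad by blast
    then obtain r where "r \<notin> insert 0 (\<Union>R\<in>\<S>. {r. v + r *s u \<in> R})"
      using ex_new_if_finite[OF inf] by blast
    then have r: "r \<noteq> 0" "\<And>R. R \<in> \<S> \<Longrightarrow> v + r *s u \<notin> R" by auto
    have "v + r *s u \<notin> S"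
    proof
      assume "v + r *s u \<in> S"
      then have "(v + r *s u) - v \<in> S" using True sub subspace_diff by blast
      then have "inverse r *s (r *s u) \<in> S" using sub subspace_scale by fastforce
      then show False using r u by simp
    qed
    moreover have "v + r *s u \<in> U"
      using U v(1) u(1) by (simp add: subspace_add subspace_scale)
    ultimately show ?thesis using r by blast
  qed
qed

lemma span_Un_absorb:
  assumes "T \<subseteq> span S"
  shows "span (S \<union> T) = span S"
proof
  show "span (S \<union> T) \<subseteq> span S"
    using assms by (intro span_minimal) (auto intro: span_base)
qed (simp add: span_mono)

text \<open>
  Think of \<open>vs\<close> as the interior of a transitive tournament with source \<open>s\<close> and sink \<open>t\<close>; arcs carry
  sets of vectors, \<open>\<alpha> j\<close> on the arc from \<open>s\<close> to \<open>j\<close> and \<open>U i j\<close> on the arc from \<open>i\<close> to \<open>j\<close>. The lists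
  \<open>ps\<close> and \<open>qs\<close> are the vertices of a path from \<open>s\<close> to the last vertex before the gap between \<open>xs\<close> and
  \<open>ys\<close> (the source itself if \<open>xs\<close> is empty) and of a path from the first vertex after the gap to \<open>t\<close>;
  \<open>zs\<close> and \<open>ws\<close> are vectors chosen on their arcs.
\<close>

definition gap_witness ::
    "'b set \<Rightarrow> ('n \<Rightarrow> 'b set) \<Rightarrow> ('n \<Rightarrow> 'n \<Rightarrow> 'b set) \<Rightarrow> 'n \<Rightarrow> 'n list \<Rightarrow>
     'n list \<Rightarrow> 'n list \<Rightarrow> 'n list \<Rightarrow> 'n list \<Rightarrow> 'b list \<Rightarrow> 'b list \<Rightarrow> bool" where
  "gap_witness B \<alpha> U t vs xs ys ps qs zs ws \<longleftrightarrow> vs = xs @ ys \<and>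
     subseq ps xs \<and> (xs \<noteq> [] \<longrightarrow> ps \<noteq> [] \<and> last ps = last xs) \<and>
     subseq qs (ys @ [t]) \<and> qs \<noteq> [] \<and> hd qs = hd (ys @ [t]) \<and> last qs = t \<and>
     list_all2 (\<in>) zs (steps \<alpha> U ps) \<and>
     list_all2 (\<in>) ws (steps (U (hd qs)) U (tl qs)) \<and>
     distinct (ws @ zs) \<and> B \<inter> set (ws @ zs) = {} \<and> independent (B \<union> set (ws @ zs))"

text \<open>Induction that contracts the first vertex into the source. \<open>B\<close> collects the
  vectors already spent, and the paths may only use vectors independent of them.\<close>

lemma gap_path_exists:
  fixes U :: "'n \<Rightarrow> 'n \<Rightarrow> 'b set"
  assumes "infinite (UNIV :: 'a set)"
    and "finite B" "independent B"
    and "sorted_wrt (\<lambda>i j. U j i = {}) vs" "\<And>i. U i i = {}"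
    and "\<And>Y. Y \<subseteq> set vs \<Longrightarrow> local.rank_ge (B \<union> arc_labels \<alpha> U t Y) (card B + card Y)"
    and "distinct vs"
  shows "\<exists>xs ys ps qs zs ws. local.gap_witness B \<alpha> U t vs xs ys ps qs zs ws"
  using assms(2-)
proof (induction vs arbitrary: B \<alpha>)
  case Nil
  show ?case
    unfolding gap_witness_def
    by (rule exI[of _ "[]"], rule exI[of _ "[]"], rule exI[of _ "[]"], rule exI[of _ "[t]"],
        rule exI[of _ "[]"], rule exI[of _ "[]"]) (use Nil in simp)
next
  case (Cons v vs)
  define \<beta> where "\<beta> = (\<lambda>j. \<alpha> j \<union> U v j)"
  have fB: "finite B" and iB: "independent B" by fact+
  have no_in: "U j v = {}" if "j \<in> insert v (set vs)" for j
    using Cons.prems(3,4) that by auto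
  show ?case
  proof (cases "U v t \<subseteq> span B")
    case False
    \<comment> \<open>The gap opens directly after the source, and the arc from \<open>v\<close> to
      \<open>t\<close> is the whole path behind it.\<close>
    then obtain x where x: "x \<in> U v t" "x \<notin> span B" by blast
    then have "x \<notin> B" using span_base by blast
    show ?thesis
      unfolding gap_witness_def
      by (rule exI[of _ "[]"], rule exI[of _ "v # vs"], rule exI[of _ "[]"], rule exI[of _ "[v, t]"],
          rule exI[of _ "[]"], rule exI[of _ "[x]"])
        (use x \<open>x \<notin> B\<close> iB in \<open>auto simp: independent_insert intro: list_emb_append2\<close>)
  next
    case True
    \<comment> \<open>The labels from \<open>v\<close> to \<open>t\<close> add nothing to the span,
      so contraction loses at most \<open>\<alpha> v\<close>.\<close>
    have split: "span (B \<union> arc_labels \<alpha> U t (insert v Y)) = span (B \<union> arc_labels \<beta> U t Y \<union> \<alpha> v)"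
      if "Y \<subseteq> set vs" for Y
    proof -
      have "arc_labels \<alpha> U t (insert v Y) = \<alpha> v \<union> U v t \<union> arc_labels \<beta> U t Y"
        unfolding \<beta>_def by (rule arc_labels_insert) (use no_in that in blast)
      then have "B \<union> arc_labels \<alpha> U t (insert v Y) = (B \<union> arc_labels \<beta> U t Y \<union> \<alpha> v) \<union> U v t"
        by blast
      moreover have "U v t \<subseteq> span (B \<union> arc_labels \<beta> U t Y \<union> \<alpha> v)"
        using True span_mono[of B "B \<union> arc_labels \<beta> U t Y \<union> \<alpha> v"] by blast
      ultimately show ?thesis
        using span_Un_absorb by simp
    qed
    have v_new: "v \<notin> set vs" using Cons.prems by simp
    \<comment> \<open>A vector \<open>b\<close> of \<open>span (\<alpha> v)\<close> in general position lies in the span attached to \<open>Y\<close> only if all of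
      \<open>\<alpha> v\<close> does, in which case that span has an extra dimension to spare. So contracting the arc from
      the source to \<open>v\<close> along \<open>b\<close> preserves the rank condition.\<close>
    define \<S> where "\<S> = {S \<in> (\<lambda>Y. span (B \<union> arc_labels \<beta> U t Y)) ` Pow (set vs). \<not> \<alpha> v \<subseteq> S}"
    have "\<exists>b\<in>span (\<alpha> v). \<forall>S\<in>\<S>. b \<notin> S"
    proof (rule subspace_avoids_subspaces[OF assms(1)])
      show "finite \<S>" unfolding \<S>_def by simp
      show "subspace S \<and> \<not> span (\<alpha> v) \<subseteq> S" if "S \<in> \<S>" for S
        using that span_superset unfolding \<S>_def by auto
    qed simp
    then obtain b where b: "b \<in> span (\<alpha> v)"
      and b_avoid: "\<And>Y. \<lbrakk>Y \<subseteq> set vs; \<not> \<alpha> v \<subseteq> span (B \<union> arc_labels \<beta> U t Y)\<rbrakk>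
        \<Longrightarrow> b \<notin> span (B \<union> arc_labels \<beta> U t Y)"
      unfolding \<S>_def by blast
    have rank: "local.rank_ge (insert b B \<union> arc_labels \<beta> U t Y) (Suc (card B + card Y))"
      if Y: "Y \<subseteq> set vs" for Y
    proof (cases "\<alpha> v \<subseteq> span (B \<union> arc_labels \<beta> U t Y)")
      case True
      then have "span (B \<union> arc_labels \<beta> U t Y \<union> \<alpha> v) = span (B \<union> arc_labels \<beta> U t Y)"
        by (rule span_Un_absorb)
      also have "\<dots> \<subseteq> span (insert b B \<union> arc_labels \<beta> U t Y)" by (rule span_mono) blast
      finally have sub: "span (B \<union> arc_labels \<alpha> U t (insert v Y)) \<subseteq> span (insert b B \<union> arc_labels \<beta> U t Y)"
        using split[OF Y] by simp
      have "card (insert v Y) = Suc (card Y)"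
        using Y v_new finite_subset by (subst card_insert_disjoint) auto
      then have "local.rank_ge (B \<union> arc_labels \<alpha> U t (insert v Y)) (Suc (card B + card Y))"
        using Cons.prems(5)[of "insert v Y"] Y by auto
      then show ?thesis using sub unfolding rank_ge_def by blast
    next
      case False
      have "local.rank_ge (B \<union> arc_labels \<alpha> U t Y) (card B + card Y)"
        using Cons.prems(5)[of Y] Y by auto
      then obtain J where J: "J \<subseteq> span (B \<union> arc_labels \<alpha> U t Y)" "independent J" "finite J"
        "card J = card B + card Y"
        unfolding rank_ge_def by blast
      have "arc_labels \<alpha> U t Y \<subseteq> arc_labels \<beta> U t Y"
        by (rule arc_labels_mono) (simp add: \<beta>_def)
      then have J': "J \<subseteq> span (B \<union> arc_labels \<beta> U t Y)"
        using J(1) span_mono[of "B \<union> arc_labels \<alpha> U t Y" "B \<union> arc_labels \<beta> U t Y"] by blast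
      then have "span J \<subseteq> span (B \<union> arc_labels \<beta> U t Y)" by (simp add: span_minimal)
      then have bJ: "b \<notin> span J" using b_avoid[OF Y False] by blast
      then have "independent (insert b J)" "b \<notin> J"
        using J(2) span_base by (auto simp: independent_insert)
      moreover have "insert b J \<subseteq> span (insert b B \<union> arc_labels \<beta> U t Y)"
        using J' span_mono[of "B \<union> arc_labels \<beta> U t Y" "insert b B \<union> arc_labels \<beta> U t Y"]
          span_base[of b "insert b B \<union> arc_labels \<beta> U t Y"] by blast
      ultimately show ?thesis using J(3,4) unfolding rank_ge_def
        by (intro exI[of _ "insert b J"]) simp
    qed
    \<comment> \<open>The rank condition for \<open>{v}\<close> keeps \<open>\<alpha> v\<close> from
      lying in \<open>span B\<close>; by the choice of \<open>b\<close>, applied to the empty set,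
      \<open>b\<close> is outside as well.\<close>
    have "b \<notin> span B"
    proof -
      have "\<not> \<alpha> v \<subseteq> span B"
      proof
        assume "\<alpha> v \<subseteq> span B"
        then have "span (B \<union> \<alpha> v) = span B"
          by (rule span_Un_absorb)
        moreover have "local.rank_ge (B \<union> arc_labels \<alpha> U t {v}) (card B + 1)"
          using Cons.prems(5)[of "{v}"] by simp
        ultimately obtain J where "J \<subseteq> span B" "independent J" "card J = card B + 1"
          using split[of "{}"] unfolding rank_ge_def by (auto simp: arc_labels_def)
        then show False using independent_span_bound[OF fB] by fastforce
      qed
      then show ?thesis using b_avoid[of "{}"] by (simp add: arc_labels_def)
    qed
    then have bB: "b \<notin> B" and ibB: "independent (insert b B)"
      using iB span_base by (auto simp: independent_insert)
    have "\<exists>xs ys ps qs zs ws. local.gap_witness (insert b B) \<beta> U t vs xs ys ps qs zs ws"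
      by (rule Cons.IH) (use fB ibB Cons.prems rank bB in auto)
    then obtain xs ys ps qs zs ws where vs: "vs = xs @ ys"
      and ps: "subseq ps xs" "xs \<noteq> [] \<longrightarrow> ps \<noteq> [] \<and> last ps = last xs"
      and qs: "subseq qs (ys @ [t])" "qs \<noteq> []" "hd qs = hd (ys @ [t])" "last qs = t"
      and zs: "list_all2 (\<in>) zs (steps \<beta> U ps)"
      and ws: "list_all2 (\<in>) ws (steps (U (hd qs)) U (tl qs))"
      and dist: "distinct (ws @ zs)" and disj: "insert b B \<inter> set (ws @ zs) = {}"
      and ind: "independent (insert b B \<union> set (ws @ zs))"
      unfolding gap_witness_def by blast
    have b_ind: "b \<notin> span (B \<union> set (ws @ zs))" and ind': "independent (B \<union> set (ws @ zs))"
      using ind bB disj by (auto simp: independent_insert split: if_splits)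
    \<comment> \<open>Exchange \<open>b\<close> for a genuine label of the contracted arc.\<close>
    have "\<not> \<alpha> v \<subseteq> span (B \<union> set (ws @ zs))"
      using b b_ind span_minimal[of "\<alpha> v" "span (B \<union> set (ws @ zs))"] by auto
    then obtain u where u: "u \<in> \<alpha> v" "u \<notin> span (B \<union> set (ws @ zs))" by blast
    then have u_new: "u \<notin> B \<union> set (ws @ zs)" using span_base by blast
    have ind_u: "independent (insert u (B \<union> set (ws @ zs)))"
      using u ind' by (simp add: independent_insert)
    show ?thesis
    proof (cases ps)
      case Nil
      \<comment> \<open>The gap followed the contracted source; after undoing the contraction it
        follows \<open>v\<close>, which the source reaches by an arc labelled
        \<open>u\<close>.\<close>
      then have "xs = []" "zs = []" using ps zs by auto
      show ?thesis
        unfolding gap_witness_def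
        by (rule exI[of _ "[v]"], rule exI[of _ ys], rule exI[of _ "[v]"], rule exI[of _ qs],
            rule exI[of _ "[u]"], rule exI[of _ ws])
          (use Nil \<open>xs = []\<close> \<open>zs = []\<close> vs qs ws dist disj u u_new ind_u in auto)
    next
      case (Cons p ps')
      then obtain z zs' where z: "zs = z # zs'" "z \<in> \<beta> p" "list_all2 (\<in>) zs' (steps (U p) U ps')"
        using zs by (auto simp: list_all2_Cons2)
      have "xs \<noteq> []" using Cons ps(1) by auto
      \<comment> \<open>An original label of the source lets the path skip \<open>v\<close>; a label
        inherited from \<open>v\<close> sends it through \<open>v\<close>, with \<open>u\<close> on
        the new first arc.\<close>
      show ?thesis
      proof (cases "z \<in> \<alpha> p")
        case True
        show ?thesis
          unfolding gap_witness_def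
          by (rule exI[of _ "v # xs"], rule exI[of _ ys], rule exI[of _ ps], rule exI[of _ qs],
              rule exI[of _ zs], rule exI[of _ ws])
            (use Cons True z vs list_emb_Cons[OF ps(1), of v] ps(2) qs ws dist disj ind' \<open>xs \<noteq> []\<close> in \<open>auto simp del: subseq_Cons2_iff\<close>)
      next
        case False
        then have "z \<in> U v p" using z unfolding \<beta>_def by blast
        show ?thesis
          unfolding gap_witness_def
          by (rule exI[of _ "v # xs"], rule exI[of _ ys], rule exI[of _ "v # ps"], rule exI[of _ qs],
              rule exI[of _ "u # zs"], rule exI[of _ ws])
            (use Cons \<open>z \<in> U v p\<close> z vs ps qs ws dist disj u u_new ind_u \<open>xs \<noteq> []\<close> in auto)
      qed
    qed
  qed
qed

end

section \<open>Colors as linearly independent unit vectors\<close>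

lemma sum_fun_apply: "(\<Sum>x\<in>S. g x) k = (\<Sum>x\<in>S. g x k)" for g :: "'i \<Rightarrow> 'c \<Rightarrow> real"
  by (induction S rule: infinite_finite_induct) auto

lemma vector_space_fun: "vector_space (\<lambda>(r::real) (f :: 'c \<Rightarrow> real) x. r * f x)"
  by unfold_locales (auto simp: fun_eq_iff algebra_simps)

definition unit_vector :: "'c \<Rightarrow> 'c \<Rightarrow> real" where
  "unit_vector k = (\<lambda>x. of_bool (x = k))"

lemma inj_unit_vector: "inj unit_vector"
  by (rule injI) (metis unit_vector_def of_bool_eq_iff)

lemma independent_unit_vectors:
  fixes K :: "'c set"
  assumes "finite K"
  shows "\<not> module.dependent (\<lambda>(r::real) f x. r * f x) (unit_vector ` K)"
proof -
  interpret vector_space "\<lambda>(r::real) (f :: 'c \<Rightarrow> real) x. r * f x"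
    by (rule vector_space_fun)
  show ?thesis
  proof (rule independent_if_scalars_zero)
    fix g and v :: "'c \<Rightarrow> real"
    assume sum0: "(\<Sum>v\<in>unit_vector ` K. (\<lambda>x. g v * v x)) = 0" and "v \<in> unit_vector ` K"
    then obtain k where k: "k \<in> K" "v = unit_vector k" by blast
    have "(\<Sum>l\<in>K. (\<lambda>x. g (unit_vector l) * unit_vector l x)) = 0"
      using sum0 by (subst (asm) sum.reindex) (auto intro: inj_on_subset[OF inj_unit_vector])
    then have "(\<Sum>l\<in>K. (\<lambda>x. g (unit_vector l) * unit_vector l x)) k = 0" by simp
    then have "(\<Sum>l\<in>K. if k = l then g (unit_vector l) else 0) = 0"
      by (simp add: sum_fun_apply unit_vector_def if_distrib of_bool_def cong: if_cong)
    then show "g v = 0" using assms k by simp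
  qed (use assms in simp)
qed

lemma subseq_set: "subseq xs ys \<Longrightarrow> set xs \<subseteq> set ys"
  by (induction rule: list_emb.induct) auto

lemma subseq_distinct: "\<lbrakk>subseq xs ys; distinct ys\<rbrakk> \<Longrightarrow> distinct xs"
  by (induction rule: list_emb.induct) (use subseq_set in auto)

subsection \<open>Rainbow reachability\<close>

definition rainbow_reach :: "('n \<Rightarrow> 'n \<Rightarrow> bool) \<Rightarrow> ('n \<Rightarrow> 'n \<Rightarrow> 'c) \<Rightarrow> 'n set \<Rightarrow> 'n \<Rightarrow> 'n \<Rightarrow> bool" where
  "rainbow_reach A c W u v \<longleftrightarrow> (\<exists>ps. set (u # ps) \<subseteq> W \<and> distinct (u # ps) \<and> last (u # ps) = v \<and>
     (\<forall>b\<in>set (steps (A u) A ps). b) \<and> distinct (steps (c u) c ps))"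

lemma rainbow_reach_refl: "u \<in> W \<Longrightarrow> rainbow_reach A c W u u"
  unfolding rainbow_reach_def by (rule exI[of _ "[]"]) simp

lemma rainbow_reach_arc: "\<lbrakk>u \<in> W; v \<in> W; u \<noteq> v; A u v\<rbrakk> \<Longrightarrow> rainbow_reach A c W u v"
  unfolding rainbow_reach_def by (rule exI[of _ "[v]"]) simp

lemma rainbow_reach_mono: "\<lbrakk>rainbow_reach A c W u v; W \<subseteq> W'\<rbrakk> \<Longrightarrow> rainbow_reach A c W' u v"
  unfolding rainbow_reach_def by blast

text \<open>A set, to serve as a label: as it has at most one element, choosing from it both
  certifies the arc and fixes its color.\<close>

definition arc_color :: "('n \<Rightarrow> 'n \<Rightarrow> bool) \<Rightarrow> ('n \<Rightarrow> 'n \<Rightarrow> 'c) \<Rightarrow> 'n \<Rightarrow> 'n \<Rightarrow> 'c set" where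
  "arc_color A c u v = (if A u v then {c u v} else {})"

lemma list_all2_steps_arc_color:
  assumes "list_all2 (\<in>) zs (steps (\<lambda>j. e ` arc_color A c i j) (\<lambda>i j. e ` arc_color A c i j) ps)"
  shows "zs = map e (steps (c i) c ps) \<and> (\<forall>b\<in>set (steps (A i) A ps). b)"
  using assms
  by (induction ps arbitrary: i zs) (auto simp: list_all2_Cons2 arc_color_def split: if_splits)

text \<open>Orientation excludes every arc on these vertices that is not counted on the left, so the
  labels are the colors of the induced subtournament.\<close>

lemma arc_labels_arc_color:
  assumes oriented: "\<And>u v. A u v \<Longrightarrow> \<not> A v u"
    and "\<And>y. y \<in> Y \<Longrightarrow> A s y" "\<And>y. y \<in> Y \<Longrightarrow> A y t" and "A t s"
  shows "insert (c t s) (arc_labels (arc_color A c s) (arc_color A c) t Y) =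
    {c u v | u v. u \<in> insert s (insert t Y) \<and> v \<in> insert s (insert t Y) \<and> A u v}"
proof -
  have no: "\<not> A s t" "\<And>y. y \<in> Y \<Longrightarrow> \<not> A y s" "\<And>y. y \<in> Y \<Longrightarrow> \<not> A t y" "\<And>v. \<not> A v v"
    using assms by blast+
  have "u \<in> insert s (insert t Y) \<and> v \<in> insert s (insert t Y) \<and> A u v \<longleftrightarrow>
    u = t \<and> v = s \<or> u = s \<and> v \<in> Y \<or> u \<in> Y \<and> v = t \<or> u \<in> Y \<and> v \<in> Y \<and> A u v" for u v
    using assms(2-4) no by blast
  then show ?thesis
    using assms(2,3) unfolding arc_labels_def arc_color_def by auto
qed

text \<open>\<open>B\<close> starts as the color of the arc from \<open>t\<close> to
  \<open>s\<close>. This arc joins the path from the gap to \<open>t\<close> with the path from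
  \<open>s\<close> to the gap.\<close>

lemma rainbow_gap:
  fixes A :: "'n \<Rightarrow> 'n \<Rightarrow> bool" and c :: "'n \<Rightarrow> 'n \<Rightarrow> 'c"
  assumes dist: "distinct (s # vs @ [t])"
    and sorted: "sorted_wrt (\<lambda>i j. \<not> A j i) vs" and irrefl: "\<And>v. \<not> A v v"
    and ts: "A t s"
    and colors: "\<And>Y. Y \<subseteq> set vs \<Longrightarrow>
      card Y + 1 \<le> card (insert (c t s) (arc_labels (arc_color A c s) (arc_color A c) t Y))"
  shows "\<exists>xs ys. vs = xs @ ys \<and>
    rainbow_reach A c (set (s # vs @ [t])) (hd (ys @ [t])) (last (s # xs))"
proof -
  interpret vector_space "\<lambda>(r::real) (f :: 'c \<Rightarrow> real) x. r * f x"
    by (rule vector_space_fun)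
  let ?C = "arc_color A c"
  let ?U = "\<lambda>i j. unit_vector ` ?C i j"
  let ?B = "{unit_vector (c t s)}"
  have rank: "local.rank_ge (?B \<union> arc_labels (?U s) ?U t Y) (card ?B + card Y)" if Y: "Y \<subseteq> set vs" for Y
  proof -
    define L where "L = insert (c t s) (arc_labels (?C s) ?C t Y)"
    obtain K where K: "K \<subseteq> L" "card K = card Y + 1" "finite K"
      using colors[OF Y] obtain_subset_with_card_n unfolding L_def by blast
    have "unit_vector ` L = ?B \<union> arc_labels (?U s) ?U t Y"
      unfolding L_def arc_labels_def by blast
    then have "unit_vector ` K \<subseteq> span (?B \<union> arc_labels (?U s) ?U t Y)"
      using K(1) span_superset by blast
    moreover have "card (unit_vector ` K) = card ?B + card Y"
      using K(2) by (simp add: card_image inj_on_subset[OF inj_unit_vector])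
    ultimately show ?thesis
      unfolding rank_ge_def using independent_unit_vectors[OF K(3)] K(3) by blast
  qed
  have "\<exists>xs ys ps qs zs ws. local.gap_witness ?B (?U s) ?U t vs xs ys ps qs zs ws"
  proof (rule gap_path_exists)
    show "independent ?B" using independent_unit_vectors[of "{c t s}"] by simp
    show "sorted_wrt (\<lambda>i j. ?U j i = {}) vs"
      using sorted by (rule sorted_wrt_mono_rel[rotated]) (simp add: arc_color_def)
  qed (use dist irrefl rank in \<open>auto simp: arc_color_def infinite_UNIV_char_0\<close>)
  then obtain xs ys ps qs zs ws where vs: "vs = xs @ ys"
    and ps: "subseq ps xs" "xs \<noteq> [] \<longrightarrow> ps \<noteq> [] \<and> last ps = last xs"
    and qs: "subseq qs (ys @ [t])" "qs \<noteq> []" "hd qs = hd (ys @ [t])" "last qs = t"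
    and zs: "list_all2 (\<in>) zs (steps (?U s) ?U ps)"
    and ws: "list_all2 (\<in>) ws (steps (?U (hd qs)) ?U (tl qs))"
    and dzw: "distinct (ws @ zs)" "?B \<inter> set (ws @ zs) = {}"
    unfolding gap_witness_def by blast
  obtain q qs' where q: "qs = q # qs'" using qs(2) by (cases qs) auto
  have last_q: "last (q # qs') = t" using qs(4) q by simp
  note zs' = list_all2_steps_arc_color[OF zs]
  have ws': "ws = map unit_vector (steps (c q) c qs') \<and> (\<forall>b\<in>set (steps (A q) A qs'). b)"
    by (rule list_all2_steps_arc_color) (use ws q in simp)
  have sub: "set ps \<subseteq> set xs" "set qs \<subseteq> set (ys @ [t])"
    by (rule subseq_set[OF ps(1)], rule subseq_set[OF qs(1)])
  have "distinct ps" "distinct qs"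
    using dist vs subseq_distinct[OF ps(1)] subseq_distinct[OF qs(1)] by auto
  then have d: "distinct (q # qs' @ s # ps)"
    using dist vs sub q by auto
  have "rainbow_reach A c (set (s # vs @ [t])) q (last (s # xs))"
    unfolding rainbow_reach_def
  proof (intro exI conjI)
    show "set (q # qs' @ s # ps) \<subseteq> set (s # vs @ [t])" using sub vs q by auto
    show "distinct (q # qs' @ s # ps)" by (rule d)
    show "last (q # qs' @ s # ps) = last (s # xs)" using ps by (cases "xs = []") auto
    show "\<forall>b\<in>set (steps (A q) A (qs' @ s # ps)). b"
      using ws' zs' ts last_q unfolding steps_append by auto
    \<comment> \<open>Disjointness from \<open>B\<close> keeps the color of the joining arc off both
      paths.\<close>
    have "distinct (steps (c q) c qs' @ steps (c s) c ps)"
      "c t s \<notin> set (steps (c q) c qs' @ steps (c s) c ps)"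
      using dzw zs' ws' by (auto simp: distinct_map simp flip: map_append)
    then show "distinct (steps (c q) c (qs' @ s # ps))"
      unfolding steps_append last_q by auto
  qed
  moreover have "q = hd (ys @ [t])" using qs(3) q by simp
  ultimately show ?thesis using vs by (intro exI[of _ xs] exI[of _ ys]) simp
qed

section \<open>Shortest cycles of a self-map and their shortest chords\<close>

lemma rainbow_reach_image_exists:
  assumes "finite W" "W \<noteq> {}"
    and f: "\<And>x. x \<in> W \<Longrightarrow> f x \<in> W"
    and semi: "\<And>u v. \<lbrakk>u \<in> W; v \<in> W; u \<noteq> v\<rbrakk> \<Longrightarrow> A u v \<or> A v u"
    and oriented: "\<And>u v. A u v \<Longrightarrow> \<not> A v u"
    and colors: "\<And>s t Y. \<lbrakk>Y \<noteq> {}; insert s (insert t Y) \<subseteq> W; \<forall>y\<in>Y. A s y \<and> A y t; A t s\<rbrakk> \<Longrightarrow>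
      card Y + 1 \<le> card {c u v | u v. u \<in> insert s (insert t Y) \<and> v \<in> insert s (insert t Y) \<and> A u v}"
  shows "\<exists>x\<in>W. rainbow_reach A c W x (f x)"
proof (rule ccontr)
  assume "\<not> ?thesis"
  then have no_reach: "\<not> rainbow_reach A c W x (f x)" if "x \<in> W" for x using that by blast
  have arc: "A (f x) x" if "x \<in> W" for x
  proof -
    have "f x \<noteq> x" using no_reach[OF that] rainbow_reach_refl[OF that] by metis
    then show ?thesis
      using semi[OF that f[OF that]] no_reach[OF that] rainbow_reach_arc[OF that f[OF that]] by metis
  qed
  have iter: "(f ^^ i) x \<in> W" if "x \<in> W" for i x
    using that f by (induction i) auto
  define per where "per n \<longleftrightarrow> 0 < n \<and> (\<exists>x\<in>W. (f ^^ n) x = x)" for n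
  have "\<exists>n. per n"
  proof -
    obtain w where w: "w \<in> W" using \<open>W \<noteq> {}\<close> by blast
    have "\<not> inj (\<lambda>i. (f ^^ i) w)"
      using iter[OF w] \<open>finite W\<close> by (meson finite_imageD finite_subset image_subsetI infinite_UNIV_nat)
    then obtain i j where ij: "i < j" "(f ^^ i) w = (f ^^ j) w"
      unfolding inj_def by (metis linorder_neqE_nat)
    have "(f ^^ (j - i)) ((f ^^ i) w) = (f ^^ (j - i + i)) w"
      by (simp only: funpow_add comp_apply)
    then have "(f ^^ (j - i)) ((f ^^ i) w) = (f ^^ i) w" using ij by simp
    then show ?thesis using ij(1) iter[OF w] unfolding per_def by (metis zero_less_diff)
  qed
  \<comment> \<open>Minimality will make any \<open>n\<close> consecutive iterates distinct.\<close>
  define n where "n = (LEAST n. per n)"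
  have "per n" unfolding n_def using \<open>\<exists>n. per n\<close> by (rule LeastI_ex)
  then obtain y where n: "0 < n" and y: "y \<in> W" "(f ^^ n) y = y" unfolding per_def by blast
  define x where "x i = (f ^^ i) y" for i
  have xW: "x i \<in> W" for i using iter y(1) unfolding x_def .
  have xS: "x (Suc i) = f (x i)" for i unfolding x_def by simp
  have arc1: "A (x (Suc i)) (x i)" for i using arc xW xS by metis
  have x_neq: "x i \<noteq> x (i + d)" if "0 < d" "d < n" for i d
  proof
    assume "x i = x (i + d)"
    then have "(f ^^ d) (x i) = x i"
      unfolding x_def by (metis add.commute comp_apply funpow_add)
    then have "per d" using that xW unfolding per_def by blast
    then show False using that Least_le[of per d] unfolding n_def by simp
  qed
  have "n \<noteq> 1" "n \<noteq> 2"
  proof -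
    have "x n = x 0" using y unfolding x_def by simp
    moreover have "x 1 \<noteq> x 0" "x 2 \<noteq> x 0"
      using arc1[of 0] arc1[of 1] oriented by (fastforce simp: numeral_2_eq_2)+
    ultimately show "n \<noteq> 1" "n \<noteq> 2" by auto
  qed
  then have n3: "3 \<le> n" using n by linarith
  define chord where "chord h \<longleftrightarrow> 2 \<le> h \<and> (\<exists>i. A (x i) (x (i + h)))" for h
  \<comment> \<open>The arc that closes the cycle is itself a chord, so a shortest one
    exists.\<close>
  have "chord (n - 1)"
  proof -
    have "A (x n) (x (n - 1))" using arc1[of "n - 1"] n by simp
    moreover have "x n = x 0" using y unfolding x_def by simp
    ultimately show ?thesis using n3 unfolding chord_def by (auto intro!: exI[of _ 0])
  qed
  define h where "h = (LEAST h. chord h)"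
  have "chord h" unfolding h_def using \<open>chord (n - 1)\<close> by (rule LeastI)
  then obtain i where h2: "2 \<le> h" and i: "A (x i) (x (i + h))" unfolding chord_def by blast
  have "h \<le> n - 1" unfolding h_def using \<open>chord (n - 1)\<close> by (rule Least_le)
  then have hn: "h < n" using n by linarith
  have no_chord: "\<not> A (x k) (x (k + d))" if "0 < d" "d < h" for k d
  proof (cases "d = 1")
    case True
    then show ?thesis using arc1[of k] oriented by auto
  next
    case False
    then show ?thesis using that not_less_Least[of d chord] unfolding h_def chord_def by auto
  qed
  have forw: "A (x (k + d)) (x k)" if "0 < d" "d < h" for k d
    using semi[OF xW xW] no_chord[OF that] x_neq[of d] that hn by (metis less_trans)
  \<comment> \<open>Reversed numbering, with the source at \<open>0\<close> and the sink at
    \<open>h\<close>.\<close>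
  define z where "z k = x (i + (h - k))" for k
  define vs where "vs = map z [1..<h]"
  have list: "z 0 # vs @ [z h] = map z [0..<Suc h]"
    using h2 unfolding vs_def by (simp add: upt_conv_Cons)
  have z_shift: "z k = x (i + (h - l) + (l - k))" if "k < l" "l \<le> h" for k l
    using that unfolding z_def by simp
  have z_neq: "z k \<noteq> z l" if "k < l" "l \<le> h" for k l
  proof -
    have "x (i + (h - l)) \<noteq> x (i + (h - l) + (l - k))"
      by (rule x_neq) (use that hn in linarith)+
    then show ?thesis using z_shift[OF that] unfolding z_def by simp
  qed
  \<comment> \<open>The last premise excludes exactly the pair \<open>0\<close>, \<open>h\<close>,
    which is joined by the chord.\<close>
  have z_arc: "A (z k) (z l)" if "k < l" "l \<le> h" "0 < k \<or> l < h" for k l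
  proof -
    have "A (x (i + (h - l) + (l - k))) (x (i + (h - l)))"
      by (rule forw) (use that in linarith)+
    then show ?thesis using z_shift[OF that(1,2)] unfolding z_def by simp
  qed
  have zh0: "A (z h) (z 0)" using i unfolding z_def by simp
  have "\<exists>xs ys. vs = xs @ ys \<and>
    rainbow_reach A c (set (z 0 # vs @ [z h])) (hd (ys @ [z h])) (last (z 0 # xs))"
  proof (rule rainbow_gap)
    show "distinct (z 0 # vs @ [z h])"
      unfolding list distinct_map using z_neq
      by (auto intro!: linorder_inj_onI simp: less_Suc_eq_le simp del: upt_Suc)
    show "sorted_wrt (\<lambda>i j. \<not> A j i) vs"
      unfolding vs_def sorted_wrt_map
      by (rule sorted_wrt_mono_rel[OF _ sorted_wrt_upt]) (use z_arc oriented in auto)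
    show "\<not> A v v" for v using oriented by blast
    show "A (z h) (z 0)" by (rule zh0)
    fix Y assume Y: "Y \<subseteq> set vs"
    have arcs: "A (z 0) y \<and> A y (z h)" if "y \<in> Y" for y
      using that Y z_arc unfolding vs_def by auto
    show "card Y + 1 \<le> card (insert (c (z h) (z 0)) (arc_labels (arc_color A c (z 0)) (arc_color A c) (z h) Y))"
    \<comment> \<open>For empty \<open>Y\<close> the assumption on colors is silent, but one color
      is enough.\<close>
    proof (cases "Y = {}")
      case False
      have "insert (z 0) (insert (z h) Y) \<subseteq> W"
        using Y xW unfolding vs_def z_def by auto
      moreover have "insert (c (z h) (z 0)) (arc_labels (arc_color A c (z 0)) (arc_color A c) (z h) Y) =
          {c u v | u v. u \<in> insert (z 0) (insert (z h) Y) \<and> v \<in> insert (z 0) (insert (z h) Y) \<and> A u v}"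
        by (rule arc_labels_arc_color) (use oriented arcs zh0 in blast)+
      ultimately show ?thesis
        using colors[OF False, of "z 0" "z h"] arcs zh0 by simp
    qed (simp add: arc_labels_def)
  qed
  then obtain xs ys where vs: "vs = xs @ ys"
    and reach: "rainbow_reach A c (set (z 0 # vs @ [z h])) (hd (ys @ [z h])) (last (z 0 # xs))"
    by blast
  \<comment> \<open>The gap lies between \<open>z l\<close> and \<open>z (Suc l)\<close>. As
    \<open>z\<close> runs against \<open>f\<close>, the path found leads from
    \<open>z (Suc l)\<close> to its image.\<close>
  define l where "l = length xs"
  have "length vs = h - 1" unfolding vs_def by simp
  then have l: "l < h" using vs h2 unfolding l_def by simp
  have split: "(z 0 # xs) @ (ys @ [z h]) = map z [0..<Suc h]" using list vs by simp
  have "last (z 0 # xs) = ((z 0 # xs) @ (ys @ [z h])) ! l"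
    by (simp add: l_def nth_append last_conv_nth)
  also have "\<dots> = z l" using l unfolding split by (simp del: upt_Suc)
  finally have last_eq: "last (z 0 # xs) = z l" .
  have "hd (ys @ [z h]) = ((z 0 # xs) @ (ys @ [z h])) ! Suc l"
    by (simp add: l_def nth_append hd_conv_nth)
  also have "\<dots> = z (Suc l)" using l unfolding split by (simp del: upt_Suc)
  finally have hd_eq: "hd (ys @ [z h]) = z (Suc l)" .
  have "z l = f (z (Suc l))"
    using l unfolding z_def xS[symmetric] by (simp add: Suc_diff_Suc)
  moreover have "set (z 0 # vs @ [z h]) \<subseteq> W" using xW unfolding vs_def z_def by auto
  ultimately have "rainbow_reach A c W (z (Suc l)) (f (z (Suc l)))"
    using reach rainbow_reach_mono unfolding last_eq hd_eq by metis
  then show False using no_reach xW unfolding z_def by blast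
qed

text \<open>A root of \<open>W - {x}\<close> fails to be a root of \<open>W\<close> only if
  \<open>x\<close> does not reach it; such roots form a self-map that contradicts the previous
  lemma.\<close>

lemma tournament_rainbow_root:
  assumes "finite W" "W \<noteq> {}"
    and "\<And>u v. \<lbrakk>u \<in> W; v \<in> W; u \<noteq> v\<rbrakk> \<Longrightarrow> A u v \<or> A v u"
    and oriented: "\<And>u v. A u v \<Longrightarrow> \<not> A v u"
    and "\<And>s t Y. \<lbrakk>Y \<noteq> {}; insert s (insert t Y) \<subseteq> W; \<forall>y\<in>Y. A s y \<and> A y t; A t s\<rbrakk> \<Longrightarrow>
      card Y + 1 \<le> card {c u v | u v. u \<in> insert s (insert t Y) \<and> v \<in> insert s (insert t Y) \<and> A u v}"
  shows "\<exists>r\<in>W. \<forall>u\<in>W. rainbow_reach A c W u r"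
  using assms(1-3,5)
proof (induction W rule: finite_psubset_induct)
  case (psubset W)
  show ?case
  proof (rule ccontr)
    assume no_root: "\<not> ?case"
    have "\<exists>r\<in>W. \<not> rainbow_reach A c W x r" if x: "x \<in> W" for x
    proof -
      have "W \<noteq> {x}" using no_root rainbow_reach_refl[OF x] by auto
      then have "W - {x} \<noteq> {}" using x by blast
      have "\<exists>r\<in>W - {x}. \<forall>u\<in>W - {x}. rainbow_reach A c (W - {x}) u r"
      proof (rule psubset.IH)
        show "W - {x} \<subset> W" using x by blast
        show "W - {x} \<noteq> {}" by fact
        show "A u v \<or> A v u" if "u \<in> W - {x}" "v \<in> W - {x}" "u \<noteq> v" for u v
          using that psubset.prems(2) by blast
      qed (rule psubset.prems(3), auto)
      then obtain r where r: "r \<in> W" "\<And>u. u \<in> W - {x} \<Longrightarrow> rainbow_reach A c (W - {x}) u r" by blast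
      then have "rainbow_reach A c W u r" if "u \<in> W - {x}" for u
        using that rainbow_reach_mono by (metis Diff_subset)
      then show ?thesis using no_root r(1) by blast
    qed
    then obtain f where f: "\<And>x. x \<in> W \<Longrightarrow> f x \<in> W" "\<And>x. x \<in> W \<Longrightarrow> \<not> rainbow_reach A c W x (f x)"
      by metis
    have "\<exists>x\<in>W. rainbow_reach A c W x (f x)"
      by (rule rainbow_reach_image_exists) (use psubset.hyps psubset.prems f(1) oriented in auto)
    then show False using f(2) by blast
  qed
qed


subsection \<open>Rainbow paths in arc-colored tournaments\<close>

context tournament
begin

text \<open>Turns vertex paths into arc walks; the choice is unique because there are no parallel
  arcs.\<close>

definition the_arc :: "'a \<Rightarrow> 'a \<Rightarrow> 'b" where
  "the_arc u v = (THE e. e \<in> arcs G \<and> tail G e = u \<and> head G e = v)"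

lemma the_arc_eq:
  assumes "e \<in> arcs G"
  shows "the_arc (tail G e) (head G e) = e"
  unfolding the_arc_def
  by (rule the_equality) (use assms no_multi_arcs in \<open>auto simp: arc_to_ends_def\<close>)

lemma the_arc:
  assumes "u \<rightarrow>\<^bsub>G\<^esub> v"
  shows "the_arc u v \<in> arcs G" "tail G (the_arc u v) = u" "head G (the_arc u v) = v"
  using assms the_arc_eq by (auto simp: arcs_ends_conv)

lemma awalk_verts_steps:
  assumes "\<forall>b\<in>set (steps (\<lambda>v. u \<rightarrow>\<^bsub>G\<^esub> v) (\<lambda>u v. u \<rightarrow>\<^bsub>G\<^esub> v) ps). b"
  shows "awalk_verts u (steps (the_arc u) the_arc ps) = u # ps"
    and "cas u (steps (the_arc u) the_arc ps) (last (u # ps))"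
    and "set (steps (the_arc u) the_arc ps) \<subseteq> arcs G"
  using assms by (induction ps arbitrary: u) (auto simp: the_arc)

lemma rainbow_reach_imp_rainbow_path:
  assumes "rainbow_reach (\<lambda>u v. u \<rightarrow>\<^bsub>G\<^esub> v) (\<lambda>u v. c (the_arc u v)) (verts G) u v"
  shows "\<exists>p. rainbow_path G c u p v"
proof -
  obtain ps where ps: "set (u # ps) \<subseteq> verts G" "distinct (u # ps)" "last (u # ps) = v"
    "\<forall>b\<in>set (steps (\<lambda>v. u \<rightarrow>\<^bsub>G\<^esub> v) (\<lambda>u v. u \<rightarrow>\<^bsub>G\<^esub> v) ps). b"
    "distinct (steps (\<lambda>v. c (the_arc u v)) (\<lambda>u v. c (the_arc u v)) ps)"
    using assms unfolding rainbow_reach_def by blast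
  have "rainbow_path G c u (steps (the_arc u) the_arc ps) v"
    using awalk_verts_steps[OF ps(4)] ps(1-3,5)
    unfolding rainbow_path_def apath_def awalk_def map_steps by simp
  then show ?thesis by blast
qed

text \<open>Every vertex of \<open>Y\<close> lies on a directed triangle with \<open>s\<close> and
  \<open>t\<close>.\<close>

lemma strongly_connected_induce:
  assumes Y: "insert s (insert t Y) \<subseteq> verts G" "Y \<noteq> {}"
    and arcs: "\<And>y. y \<in> Y \<Longrightarrow> s \<rightarrow>\<^bsub>G\<^esub> y" "\<And>y. y \<in> Y \<Longrightarrow> y \<rightarrow>\<^bsub>G\<^esub> t" "t \<rightarrow>\<^bsub>G\<^esub> s"
  shows "strongly_connected (G \<restriction> insert s (insert t Y))"
proof -
  let ?H = "G \<restriction> insert s (insert t Y)"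
  interpret H: wf_digraph ?H by (rule wellformed_induce_subgraph)
  have adj: "u \<rightarrow>\<^bsub>?H\<^esub> v"
    if "u \<rightarrow>\<^bsub>G\<^esub> v" "u \<in> insert s (insert t Y)" "v \<in> insert s (insert t Y)" for u v
    using that by (auto simp: arcs_ends_conv)
  have ts: "t \<rightarrow>\<^sup>*\<^bsub>?H\<^esub> s" using adj arcs(3) by blast
  have sy: "s \<rightarrow>\<^sup>*\<^bsub>?H\<^esub> y" "y \<rightarrow>\<^sup>*\<^bsub>?H\<^esub> t" if "y \<in> Y" for y
    using adj arcs(1,2) that by blast+
  have st: "s \<rightarrow>\<^sup>*\<^bsub>?H\<^esub> t" using sy Y(2) H.reachable_trans by blast
  have via_s: "s \<rightarrow>\<^sup>*\<^bsub>?H\<^esub> u" "u \<rightarrow>\<^sup>*\<^bsub>?H\<^esub> s" if "u \<in> verts ?H" for u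
  proof -
    have "u = s \<or> u = t \<or> u \<in> Y" using that by auto
    then show "s \<rightarrow>\<^sup>*\<^bsub>?H\<^esub> u" "u \<rightarrow>\<^sup>*\<^bsub>?H\<^esub> s"
      using sy st ts H.reachable_refl[OF that] H.reachable_trans by blast+
  qed
  show ?thesis
  proof
    show "u \<rightarrow>\<^sup>*\<^bsub>?H\<^esub> v" if "u \<in> verts ?H" "v \<in> verts ?H" for u v
      using via_s(2)[OF that(1)] via_s(1)[OF that(2)] by (rule H.reachable_trans)
  qed simp
qed

end

theorem theorem2:
  fixes T :: "('a, 'b) pre_digraph" and c :: "'b \<Rightarrow> 'c"
  assumes "tournament T"
    and "\<And>k H. \<lbrakk>3 \<le> k; k \<le> card (verts T); induced_subgraph H T; card (verts H) = k;
           strongly_connected H\<rbrakk> \<Longrightarrow> colored_with_at_least c (k - 1) H"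
  shows "\<exists>S. rainbow_path_kernel T c S"
proof (cases "verts T = {}")
  case True
  then show ?thesis unfolding rainbow_path_kernel_def by (intro exI[of _ "{}"]) simp
next
  case False
  interpret tournament T by (rule assms(1))
  let ?A = "\<lambda>u v. u \<rightarrow>\<^bsub>T\<^esub> v" and ?c = "\<lambda>u v. c (the_arc u v)"
  \<comment> \<open>A root alone is a kernel, since independence is vacuous for a singleton.\<close>
  have "\<exists>r\<in>verts T. \<forall>u\<in>verts T. rainbow_reach ?A ?c (verts T) u r"
  proof (rule tournament_rainbow_root)
    fix s t :: 'a and Y
    let ?X = "insert s (insert t Y)"
    assume Y: "Y \<noteq> {}" "?X \<subseteq> verts T" "\<forall>y\<in>Y. ?A s y \<and> ?A y t" and ts: "?A t s"
    have new: "s \<noteq> t" "s \<notin> Y" "t \<notin> Y" using ts Y(3) oriented by blast+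
    have fin: "finite Y" using finite_subset[OF Y(2) finite_verts] by simp
    have card_X: "card ?X = card Y + 2" using new fin by simp
    have "1 \<le> card Y" using fin Y(1) by (simp add: Suc_le_eq card_gt_0_iff)
    \<comment> \<open>The \<open>card Y + 2\<close> vertices of \<open>?X\<close> number at least
      three, so the hypothesis of the theorem applies to them.\<close>
    then have "colored_with_at_least c (card Y + 2 - 1) (T \<restriction> ?X)"
    proof (intro assms(2))
      show "card Y + 2 \<le> card (verts T)"
        using card_mono[OF finite_verts Y(2)] card_X by simp
      show "induced_subgraph (T \<restriction> ?X) T" using Y(2) by (rule induced_induce)
      show "strongly_connected (T \<restriction> ?X)"
        using Y ts by (intro strongly_connected_induce) auto
    qed (use card_X in auto)
    moreover have "c ` arcs (T \<restriction> ?X) = {?c u v | u v. u \<in> ?X \<and> v \<in> ?X \<and> ?A u v}"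
    proof (intro set_eqI iffI)
      fix k assume "k \<in> c ` arcs (T \<restriction> ?X)"
      then obtain e where e: "k = c e" "e \<in> arcs T" "tail T e \<in> ?X" "head T e \<in> ?X" by auto
      moreover have "?A (tail T e) (head T e)" using e(2) by (auto simp: arcs_ends_conv)
      moreover have "k = ?c (tail T e) (head T e)" using e(1,2) the_arc_eq by simp
      ultimately show "k \<in> {?c u v | u v. u \<in> ?X \<and> v \<in> ?X \<and> ?A u v}" by blast
    qed (use the_arc in auto)
    ultimately show "card Y + 1 \<le> card {?c u v | u v. u \<in> ?X \<and> v \<in> ?X \<and> ?A u v}"
      unfolding colored_with_at_least_def by simp
  qed (use False semicomplete oriented in auto)
  then obtain r where r: "r \<in> verts T" "\<And>u. u \<in> verts T \<Longrightarrow> rainbow_reach ?A ?c (verts T) u r"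
    by blast
  have "\<exists>p. rainbow_path T c u p r" if "u \<in> verts T" for u
    by (rule rainbow_reach_imp_rainbow_path[OF r(2)[OF that]])
  then have "rainbow_path_kernel T c {r}"
    using r(1) unfolding rainbow_path_kernel_def by simp
  then show ?thesis ..
qed

end
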